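(* Let $(\mathcal{X}\times\mathcal{Y}\times\mathcal{Z},\mathcal{F},\mathcal{P}_{XYZ})$ be a probability space, let $\mathcal{P}_Z$ be the induced marginal distribution of $Z$ and let $\mathcal{P}_{X|Z}$, $\mathcal{P}_{Y|Z}$ be the induced conditional distributions. Assume that $\mathcal{P}_{XYZ}\ll \mathcal{P}_Z\mathcal{P}_{Y|Z}\mathcal{P}_{X|Z}$. Given $E\in\mathcal{F}$ and $z\in\mathcal{Z}$, $y\in\mathcal{Y}$, let $E_{z,y}=\{x : (x,y,z)\in E\}$. Then, for every fixed $\alpha\geq 1$, $$\mathcal{P}_{XYZ}(E)\leq \left(\mathbb{E}_{Z}\left[\operatorname*{ess\,sup}_{\mathcal{P}_{Y|Z}}\mathcal{P}_{X|Z}(E_{Z,Y})\right]\right)^{\frac{\alpha-1}{\alpha}}\cdot \exp\left(\frac{\alpha-1}{\alpha}I_\alpha^{Y|Z}(X,Y|Z)\right).$$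
   Context: $X,Y,Z$ are the coordinate random variables, jointly distributed according to $\mathcal{P}_{XYZ}$. $\mathcal{P}_Z\mathcal{P}_{Y|Z}\mathcal{P}_{X|Z}$ denotes the measure on $\mathcal{X}\times\mathcal{Y}\times\mathcal{Z}$ under which $Z\sim\mathcal{P}_Z$ and, given $Z$, $X$ and $Y$ are independent with conditional laws $\mathcal{P}_{X|Z}$ and $\mathcal{P}_{Y|Z}$ (Markov chain $X-Z-Y$). For each value $z$, $\operatorname{ess\,sup}_{\mathcal{P}_{Y|Z}}$ is the essential supremum over $y$ with respect to $\mathcal{P}_{Y|Z=z}$ of $y\mapsto \mathcal{P}_{X|Z=z}(E_{z,y})$; the outer expectation is over $Z\sim\mathcal{P}_Z$. Rényi divergence: for $\alpha>0$, $\alpha\neq 1$, and probability measures $\mathcal{P},\mathcal{Q}$ with densities $p,q$ with respect to a common dominating measure $\mu$, $D_\alpha(\mathcal{P}\|\mathcal{Q})=\frac{1}{\alpha-1}\log\int p^\alpha q^{1-\alpha}\,d\mu$ ($=+\infty$ if $\alpha>1$ and $\mathcal{P}\not\ll\mathcal{Q}$); $D_1$ is the Kullback–Leibler divergence. $\log$ is the natural logarithm. Definition: $I^{Y|Z}_\alpha(X,Y|Z)=\min_{\mathcal{Q}_{Y|Z}} D_\alpha(\mathcal{P}_{XYZ}\|\mathcal{P}_{X|Z}\mathcal{Q}_{Y|Z}\mathcal{P}_Z)$, where the minimum is over all conditional distributions (Markov kernels) $\mathcal{Q}_{Y|Z}$ from $\mathcal{Z}$ to $\mathcal{Y}$. 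*)

theory Defs
  imports "HOL-Probability.Probability"
begin

definition ln_ennreal :: "ennreal \<Rightarrow> ereal" where
  "ln_ennreal x = (if x = 0 then -\<infinity> else if x = \<infinity> then \<infinity> else ereal (ln (enn2real x)))"

definition exp_ereal :: "ereal \<Rightarrow> ennreal" where
  "exp_ereal x = (if x = -\<infinity> then 0 else if x = \<infinity> then \<infinity> else ennreal (exp (real_of_ereal x)))"

definition sum_measure :: "'a measure \<Rightarrow> 'a measure \<Rightarrow> 'a measure" where
  "sum_measure P Q = measure_of (space P) (sets P) (\<lambda>A. emeasure P A + emeasure Q A)"

text \<open>The integral of \<open>p\<^sup>\<alpha> q\<^sup>1\<^sup>-\<^sup>\<alpha>\<close>, where \<open>p\<close>, \<open>q\<close> are the densities of \<open>P\<close>, \<open>Q\<close> with respect to the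
  dominating measure \<open>P + Q\<close>. By \<open>renyi_integral_density\<close> below, any sigma-finite dominating measure
  gives the same value. Since \<open>0 powr _ = 0\<close>, the integrand is \<open>0\<close> where \<open>p = 0\<close> or \<open>q = 0\<close>;
  for \<open>\<alpha> > 1\<close> this is only meaningful if \<open>P \<lless> Q\<close>, and \<open>renyi_div\<close> treats the
  other case separately.\<close>

definition renyi_integral :: "real \<Rightarrow> 'a measure \<Rightarrow> 'a measure \<Rightarrow> ennreal" where
  "renyi_integral \<alpha> P Q =
     (let \<mu> = sum_measure P Q in
      \<integral>\<^sup>+ w. ennreal (enn2real (RN_deriv \<mu> P w) powr \<alpha> * enn2real (RN_deriv \<mu> Q w) powr (1 - \<alpha>)) \<partial>\<mu>)"

text \<open>The library's \<open>KL_divergence b Q P\<close> is the divergence of \<open>P\<close> from \<open>Q\<close> (in this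
  order of arguments). It is real-valued, so the value \<open>\<infinity>\<close> has to be added. The negative part of
  \<open>ln (dP/dQ)\<close> is always \<open>P\<close>-integrable for probability measures \<open>P \<lless> Q\<close>, so failure of
  integrability means that the integral is \<open>\<infinity>\<close>.\<close>

definition kl_div :: "'a measure \<Rightarrow> 'a measure \<Rightarrow> ereal" where
  "kl_div P Q =
     (if absolutely_continuous Q P \<and> integrable P (entropy_density (exp 1) Q P)
      then ereal (KL_divergence (exp 1) Q P) else \<infinity>)"

definition renyi_div :: "real \<Rightarrow> 'a measure \<Rightarrow> 'a measure \<Rightarrow> ereal" where
  "renyi_div \<alpha> P Q =
     (if \<alpha> = 1 then kl_div P Q
      else if \<alpha> > 1 \<and> \<not> absolutely_continuous Q P then \<infinity>
      else ereal (1 / (\<alpha> - 1)) * ln_ennreal (renyi_integral \<alpha> P Q))"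

lemma sets_sum_measure [simp, measurable_cong]: "sets (sum_measure P Q) = sets P"
  unfolding sum_measure_def by simp

lemma space_sum_measure [simp]: "space (sum_measure P Q) = space P"
  unfolding sum_measure_def by simp

lemma emeasure_sum_measure:
  assumes "sets Q = sets P" "A \<in> sets P"
  shows "emeasure (sum_measure P Q) A = emeasure P A + emeasure Q A"
proof (rule emeasure_measure_of[OF sum_measure_def])
  show "countably_additive (sets (sum_measure P Q)) (\<lambda>A. emeasure P A + emeasure Q A)"
  proof (rule countably_additiveI)
    fix F :: "nat \<Rightarrow> _"
    assume "range F \<subseteq> sets (sum_measure P Q)" "disjoint_family F"
    then show "(\<Sum>i. emeasure P (F i) + emeasure Q (F i)) = emeasure P (\<Union> (range F)) + emeasure Q (\<Union> (range F))"
      using assms(1) by (simp add: suminf_add[symmetric] suminf_emeasure)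
  qed
qed (use assms in \<open>auto simp: positive_def sets.space_closed dest: sets.sets_into_space\<close>)

lemma sum_measure_density:
  assumes [measurable]: "p \<in> borel_measurable \<mu>" "q \<in> borel_measurable \<mu>"
  shows "sum_measure (density \<mu> p) (density \<mu> q) = density \<mu> (\<lambda>w. p w + q w)"
proof (rule measure_eqI)
  fix A assume "A \<in> sets (sum_measure (density \<mu> p) (density \<mu> q))"
  then have [measurable]: "A \<in> sets \<mu>" by simp
  show "emeasure (sum_measure (density \<mu> p) (density \<mu> q)) A = emeasure (density \<mu> (\<lambda>w. p w + q w)) A"
    by (simp add: emeasure_sum_measure emeasure_density nn_integral_add[symmetric] distrib_right)
qed simp

lemma renyi_integral_density:
  fixes p q :: "'a \<Rightarrow> real"
  assumes "sigma_finite_measure \<mu>"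
    and [measurable]: "p \<in> borel_measurable \<mu>" "q \<in> borel_measurable \<mu>"
    and nonneg: "\<And>w. 0 \<le> p w" "\<And>w. 0 \<le> q w"
    and PQ: "P = density \<mu> p" "Q = density \<mu> q"
    and prob: "prob_space P" "prob_space Q"
  shows "renyi_integral \<alpha> P Q = (\<integral>\<^sup>+ w. ennreal (p w powr \<alpha> * q w powr (1 - \<alpha>)) \<partial>\<mu>)"
proof -
  interpret \<mu>: sigma_finite_measure \<mu> by fact
  interpret P: prob_space P by fact
  interpret Q: prob_space Q by fact
  define s where "s w = p w + q w" for w
  define \<nu> where "\<nu> = sum_measure P Q"
  have [measurable]: "s \<in> borel_measurable \<mu>" unfolding s_def by simp
  have \<nu>: "\<nu> = density \<mu> (\<lambda>w. ennreal (s w))"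
    unfolding \<nu>_def PQ sum_measure_density[of "\<lambda>w. ennreal (p w)" \<mu> "\<lambda>w. ennreal (q w)", simplified]
    using nonneg by (simp add: s_def)
  have sets[simp]: "sets Q = sets P" "sets \<nu> = sets P" "sets P = sets \<mu>"
    by (simp_all add: PQ \<nu>)
  have [simp]: "space P = space \<mu>" by (simp add: PQ)
  have em\<nu>: "emeasure \<nu> A = emeasure P A + emeasure Q A" if "A \<in> sets P" for A
    unfolding \<nu>_def using that by (simp add: emeasure_sum_measure)
  interpret \<nu>: finite_measure \<nu>
  proof
    show "emeasure \<nu> (space \<nu>) \<noteq> \<infinity>"
      using em\<nu>[of "space \<nu>"] sets.top[of \<nu>] P.emeasure_finite Q.emeasure_finite by simp
  qed
  have ac: "absolutely_continuous \<nu> P" "absolutely_continuous \<nu> Q"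
    unfolding absolutely_continuous_def by (auto simp: null_sets_def em\<nu>)
  have meas_eq: "borel_measurable \<nu> = (borel_measurable \<mu> :: ('a \<Rightarrow> ennreal) set)"
    by (rule measurable_cong_sets) auto
  have RN_meas[measurable]: "RN_deriv \<nu> M \<in> borel_measurable \<mu>" for M
    using borel_measurable_RN_deriv[of \<nu> M] unfolding meas_eq .
  have RN: "AE w in \<mu>. ennreal (s w) * RN_deriv \<nu> R w = ennreal (r w)"
    if R: "R = density \<mu> r" "absolutely_continuous \<nu> R" and [measurable]: "r \<in> borel_measurable \<mu>"
    for R and r :: "'a \<Rightarrow> real"
  proof -
    have "density \<mu> (\<lambda>w. ennreal (s w) * RN_deriv \<nu> R w) = density \<nu> (RN_deriv \<nu> R)"
      unfolding \<nu> using RN_meas[of R, unfolded \<nu>] by (simp add: density_density_eq)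
    also have "\<dots> = density \<mu> r"
      using R by (subst \<nu>.density_RN_deriv) (auto simp: R(1))
    finally show ?thesis
      by (subst (asm) \<mu>.density_unique_iff) auto
  qed
  have "renyi_integral \<alpha> P Q = (\<integral>\<^sup>+ w. ennreal (enn2real (RN_deriv \<nu> P w) powr \<alpha>
      * enn2real (RN_deriv \<nu> Q w) powr (1 - \<alpha>)) \<partial>\<nu>)"
    by (simp add: renyi_integral_def Let_def \<nu>_def)
  also have "\<dots> = (\<integral>\<^sup>+ w. ennreal (s w) * ennreal (enn2real (RN_deriv \<nu> P w) powr \<alpha>
      * enn2real (RN_deriv \<nu> Q w) powr (1 - \<alpha>)) \<partial>\<mu>)"
    using nn_integral_density[of "\<lambda>w. ennreal (s w)" \<mu> "\<lambda>w. ennreal (enn2real (RN_deriv \<nu> P w) powr \<alpha>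
      * enn2real (RN_deriv \<nu> Q w) powr (1 - \<alpha>))"]
    unfolding \<nu>[symmetric] by simp
  also have "\<dots> = (\<integral>\<^sup>+ w. ennreal (p w powr \<alpha> * q w powr (1 - \<alpha>)) \<partial>\<mu>)"
  proof (rule nn_integral_cong_AE)
    show "AE w in \<mu>. ennreal (s w) * ennreal (enn2real (RN_deriv \<nu> P w) powr \<alpha>
        * enn2real (RN_deriv \<nu> Q w) powr (1 - \<alpha>)) = ennreal (p w powr \<alpha> * q w powr (1 - \<alpha>))"
      using RN[OF PQ(1) ac(1) assms(2)] RN[OF PQ(2) ac(2) assms(3)]
    proof (eventually_elim)
      case (elim w)
      show ?case
      proof (cases "s w = 0")
        case True
        then have "p w = 0" using nonneg[of w] by (simp add: s_def)
        then show ?thesis using True by simp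
      next
        case False
        then have s: "s w > 0" using nonneg[of w] by (simp add: s_def)
        have eq: "enn2real a = r / s w" if "ennreal (s w) * a = ennreal r" "0 \<le> r" for a r
        proof -
          have "s w * enn2real a = r"
            using arg_cong[OF that(1), of enn2real] that(2) s
            by (simp only: enn2real_mult enn2real_ennreal less_imp_le)
          then show ?thesis using s by (simp add: field_simps)
        qed
        have "s w * ((p w / s w) powr \<alpha> * (q w / s w) powr (1 - \<alpha>))
            = p w powr \<alpha> * q w powr (1 - \<alpha>) * (s w / (s w powr \<alpha> * s w powr (1 - \<alpha>)))"
          using s nonneg[of w] by (simp add: powr_divide)
        also have "s w powr \<alpha> * s w powr (1 - \<alpha>) = s w"
          using s by (simp add: powr_add[symmetric])
        finally show ?thesis
          using s nonneg[of w] eq[OF elim(1)] eq[OF elim(2)]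
          by (simp add: ennreal_mult'[symmetric])
      qed
    qed
  qed
  finally show ?thesis .
qed

text \<open>\<open>K\<close> is a version of the (regular) conditional distribution of \<open>U\<close> given \<open>V\<close> under \<open>P\<close>.\<close>

definition cond_distr ::
  "'w measure \<Rightarrow> 'u measure \<Rightarrow> ('w \<Rightarrow> 'u) \<Rightarrow> 'v measure \<Rightarrow> ('w \<Rightarrow> 'v) \<Rightarrow> ('v \<Rightarrow> 'u measure) \<Rightarrow> bool" where
  "cond_distr P MU U MV V K \<longleftrightarrow>
     K \<in> MV \<rightarrow>\<^sub>M prob_algebra MU \<and>
     (\<forall>A\<in>sets MU. \<forall>B\<in>sets MV.
        emeasure P {w \<in> space P. U w \<in> A \<and> V w \<in> B} = (\<integral>\<^sup>+ v\<in>B. emeasure (K v) A \<partial>distr P MV V))"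

abbreviation coord_X :: "'x \<times> 'y \<times> 'z \<Rightarrow> 'x" where "coord_X w \<equiv> fst w"
abbreviation coord_Y :: "'x \<times> 'y \<times> 'z \<Rightarrow> 'y" where "coord_Y w \<equiv> fst (snd w)"
abbreviation coord_Z :: "'x \<times> 'y \<times> 'z \<Rightarrow> 'z" where "coord_Z w \<equiv> snd (snd w)"

text \<open>The law of \<open>(X, Y, Z)\<close> when \<open>Z \<sim> R\<close> and, given \<open>Z = z\<close>, \<open>X \<sim> KX z\<close> and \<open>Y \<sim> KY z\<close> are
  independent.\<close>

definition markov_product ::
  "'x measure \<Rightarrow> 'y measure \<Rightarrow> 'z measure \<Rightarrow> 'z measure \<Rightarrow> ('z \<Rightarrow> 'y measure) \<Rightarrow> ('z \<Rightarrow> 'x measure)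
     \<Rightarrow> ('x \<times> 'y \<times> 'z) measure" where
  "markov_product MX MY MZ R KY KX =
     do { z \<leftarrow> R; y \<leftarrow> KY z; x \<leftarrow> KX z; return (MX \<Otimes>\<^sub>M MY \<Otimes>\<^sub>M MZ) (x, y, z) }"

text \<open>The minimum over all Markov kernels \<open>Q\<close> is rendered as the infimum in the extended reals,
  with which it coincides whenever it is attained. The set of kernels is nonempty as soon as \<open>MY\<close>
  carries a probability measure.
  \<open>KX\<close> is a version of the conditional distribution of \<open>X\<close> given \<open>Z\<close>.\<close>

definition cond_sibson_mi ::
  "real \<Rightarrow> 'x measure \<Rightarrow> 'y measure \<Rightarrow> 'z measure \<Rightarrow> ('x \<times> 'y \<times> 'z) measure \<Rightarrow> ('z \<Rightarrow> 'x measure)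
     \<Rightarrow> ereal" where
  "cond_sibson_mi \<alpha> MX MY MZ P KX =
     (INF Q \<in> MZ \<rightarrow>\<^sub>M prob_algebra MY.
        renyi_div \<alpha> P (markov_product MX MY MZ (distr P MZ coord_Z) Q KX))"

end

theory Submission
  imports Defs
begin

text \<open>
  For a kernel \<open>Q\<close>, let \<open>R\<close> be the law under which \<open>X\<close> and \<open>Y\<close> are independent given \<open>Z\<close>, with
  kernels \<open>KX\<close> and \<open>Q\<close>. If \<open>P\<close> has density \<open>p\<close> with respect to \<open>R\<close>, then \<open>P A\<close> is the integral of
  \<open>p \<cdot> 1\<^sub>A\<close>, and Hoelder's inequality with exponents \<open>\<alpha>\<close> and \<open>\<alpha> / (\<alpha> - 1)\<close> bounds it by
  \<open>(\<integral> p\<^sup>\<alpha> dR)\<^bsup>1/\<alpha>\<^esup> (R A)\<^bsup>(\<alpha>-1)/\<alpha>\<^esup>\<close>, where the first factor is the exponential of \<open>(\<alpha> - 1) / \<alpha>\<close> times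
  the Renyi divergence of \<open>P\<close> from \<open>R\<close>. This is applied to the part \<open>A\<close> of \<open>E\<close> on which the slice probabilities do not exceed their essential
  supremum under \<open>KY\<close>: by absolute continuity \<open>P\<close> does not charge the rest of \<open>E\<close>, and \<open>R A\<close> is at
  most the expected essential supremum, whatever \<open>Q\<close> is. The bound then passes to the infimum over \<open>Q\<close>.
\<close>

section \<open>Kernels: essential suprema, the conditionally independent law, slices\<close>

text \<open>A sublevel set is described by a null condition: \<open>K z\<close> gives mass 0 to the
  points where \<open>f z\<close> exceeds \<open>c\<close>. Masses of measurable sections depend
  measurably on \<open>z\<close>. This is what makes the set \<open>N\<close> of the final proof
  measurable.\<close>

lemma measurable_esssup_kernel:
  fixes f :: "'a \<Rightarrow> 'b \<Rightarrow> ennreal"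
  assumes f[measurable]: "case_prod f \<in> borel_measurable (M \<Otimes>\<^sub>M N)"
    and K[measurable]: "K \<in> M \<rightarrow>\<^sub>M prob_algebra N"
  shows "(\<lambda>z. esssup (K z) (f z)) \<in> borel_measurable M"
proof (rule borel_measurableI_le)
  fix c :: ennreal
  have K': "K \<in> M \<rightarrow>\<^sub>M subprob_algebra N" by (rule measurable_prob_algebraD) fact
  have "esssup (K z) (f z) \<le> c \<longleftrightarrow> emeasure (K z) {y \<in> space N. c < f z y} = 0"
    if z: "z \<in> space M" for z
  proof -
    have Kz: "sets (K z) = sets N" "space (K z) = space N"
      using subprob_measurableD[OF K' z] by auto
    have fz: "f z \<in> borel_measurable (K z)"
      using measurable_Pair2[OF f z] Kz by (simp cong: measurable_cong_sets)
    have "esssup (K z) (f z) \<le> c \<longleftrightarrow> (AE y in K z. f z y \<le> c)"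
      using esssup_I[OF fz] esssup_AE[of "f z" "K z"] by (auto elim: eventually_mono intro: order_trans)
    also have "\<dots> \<longleftrightarrow> emeasure (K z) {y \<in> space N. c < f z y} = 0"
    proof (rule AE_iff_measurable)
      show "{y \<in> space N. c < f z y} \<in> sets (K z)"
        using fz unfolding Kz(2)[symmetric] by measurable
    qed (auto simp: Kz(2) not_le)
    finally show ?thesis .
  qed
  then have "{z \<in> space M. esssup (K z) (f z) \<le> c}
      = {z \<in> space M. emeasure (K z) {y \<in> space N. c < f z y} = 0}"
    by auto
  also have "\<dots> \<in> sets M"
  proof -
    have "(SIGMA z:space M. {y \<in> space N. c < f z y})
        = {w \<in> space (M \<Otimes>\<^sub>M N). c < case_prod f w}"
      by (auto simp: space_pair_measure)
    then have "(SIGMA z:space M. {y \<in> space N. c < f z y}) \<in> sets (M \<Otimes>\<^sub>M N)"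
      by simp
    from emeasure_measurable_subprob_algebra2[OF this K'] show ?thesis
      by simp
  qed
  finally show "{z \<in> space M. esssup (K z) (f z) \<le> c} \<in> sets M" .
qed

lemma
  assumes R: "R \<in> space (prob_algebra MZ)"
    and KY[measurable]: "KY \<in> MZ \<rightarrow>\<^sub>M prob_algebra MY"
    and KX[measurable]: "KX \<in> MZ \<rightarrow>\<^sub>M prob_algebra MX"
  shows prob_space_markov_product: "prob_space (markov_product MX MY MZ R KY KX)"
    and sets_markov_product: "sets (markov_product MX MY MZ R KY KX) = sets (MX \<Otimes>\<^sub>M MY \<Otimes>\<^sub>M MZ)"
    and emeasure_markov_product: "\<And>A. A \<in> sets (MX \<Otimes>\<^sub>M MY \<Otimes>\<^sub>M MZ) \<Longrightarrow>
      emeasure (markov_product MX MY MZ R KY KX) A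
        = (\<integral>\<^sup>+ z. \<integral>\<^sup>+ y. emeasure (KX z) {x. (x, y, z) \<in> A} \<partial>KY z \<partial>R)"
proof -
  let ?M = "MX \<Otimes>\<^sub>M MY \<Otimes>\<^sub>M MZ"
  let ?ret = "\<lambda>z y x. return ?M (x, y, z)"
  \<comment> \<open>Joint measurability in \<open>(z, y)\<close>; fixing \<open>z\<close> then
    yields the kernel in \<open>y\<close> for the middle bind.\<close>
  have inner: "(\<lambda>(z, y). KX z \<bind> ?ret z y) \<in> MZ \<Otimes>\<^sub>M MY \<rightarrow>\<^sub>M prob_algebra ?M"
    by measurable
  have outer: "(\<lambda>z. KY z \<bind> (\<lambda>y. KX z \<bind> ?ret z y)) \<in> MZ \<rightarrow>\<^sub>M prob_algebra ?M"
    by measurable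
  show "prob_space (markov_product MX MY MZ R KY KX)"
    unfolding markov_product_def by (rule prob_space_bind'[OF R outer])
  show "sets (markov_product MX MY MZ R KY KX) = sets ?M"
    unfolding markov_product_def by (rule sets_bind'[OF R outer])
  fix A assume A[measurable]: "A \<in> sets ?M"
  have "emeasure (KX z \<bind> ?ret z y) A = emeasure (KX z) {x. (x, y, z) \<in> A}"
    if z: "z \<in> space MZ" and y: "y \<in> space MY" for z y
  proof -
    have KXz: "KX z \<in> space (prob_algebra MX)"
      using KX z by (rule measurable_space)
    then have [simp]: "sets (KX z) = sets MX" "space (KX z) = space MX"
      by (auto simp: space_prob_algebra dest: sets_eq_imp_space_eq)
    have slice: "(\<lambda>x. (x, y, z)) \<in> MX \<rightarrow>\<^sub>M ?M"
      using z y by measurable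
    have ret: "?ret z y \<in> MX \<rightarrow>\<^sub>M prob_algebra ?M"
      using slice by (rule measurable_compose) (rule measurable_return_prob_space)
    have "emeasure (KX z \<bind> ?ret z y) A = (\<integral>\<^sup>+ x. indicator A (x, y, z) \<partial>KX z)"
      by (subst emeasure_bind_prob_algebra[OF KXz ret A]) simp
    also have "\<dots> = (\<integral>\<^sup>+ x. indicator {x. (x, y, z) \<in> A} x \<partial>KX z)"
      by (intro nn_integral_cong) (auto split: split_indicator)
    also have "\<dots> = emeasure (KX z) {x. (x, y, z) \<in> A}"
    proof (rule nn_integral_indicator)
      have "{x. (x, y, z) \<in> A} = (\<lambda>x. (x, y, z)) -` A \<inter> space MX"
        using sets.sets_into_space[OF A] by (auto simp: space_pair_measure)
      then show "{x. (x, y, z) \<in> A} \<in> sets (KX z)"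
        using measurable_sets[OF slice A] by simp
    qed
    finally show ?thesis .
  qed
  moreover have "emeasure (KY z \<bind> (\<lambda>y. KX z \<bind> ?ret z y)) A
      = (\<integral>\<^sup>+ y. emeasure (KX z \<bind> ?ret z y) A \<partial>KY z)" if z: "z \<in> space MZ" for z
    by (rule emeasure_bind_prob_algebra[OF measurable_space[OF KY z] _ A])
       (use measurable_Pair2[OF inner z] in simp)
  moreover have "space (KY z) = space MY" if "z \<in> space MZ" for z
    using measurable_space[OF KY that] by (auto simp: space_prob_algebra dest: sets_eq_imp_space_eq)
  moreover have "space R = space MZ"
    using R by (auto simp: space_prob_algebra dest: sets_eq_imp_space_eq)
  ultimately show "emeasure (markov_product MX MY MZ R KY KX) A
        = (\<integral>\<^sup>+ z. \<integral>\<^sup>+ y. emeasure (KX z) {x. (x, y, z) \<in> A} \<partial>KY z \<partial>R)"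
    unfolding markov_product_def
    by (subst emeasure_bind_prob_algebra[OF R outer A]) (auto intro!: nn_integral_cong)
qed

lemma measurable_emeasure_slice:
  assumes E[measurable]: "E \<in> sets (MX \<Otimes>\<^sub>M MY \<Otimes>\<^sub>M MZ)"
    and K[measurable]: "K \<in> MZ \<rightarrow>\<^sub>M prob_algebra MX"
  shows "(\<lambda>(z, y). emeasure (K z) {x. (x, y, z) \<in> E}) \<in> borel_measurable (MZ \<Otimes>\<^sub>M MY)"
proof -
  \<comment> \<open>The coordinates are reordered so that \<open>(z, y)\<close> is the parameter and
    \<open>x\<close> the coordinate measured by the kernel.\<close>
  have "(SIGMA w:space (MZ \<Otimes>\<^sub>M MY). {x. (x, snd w, fst w) \<in> E})
      = (\<lambda>(w, x). (x, snd w, fst w)) -` E \<inter> space ((MZ \<Otimes>\<^sub>M MY) \<Otimes>\<^sub>M MX)"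
    using sets.sets_into_space[OF E] by (auto simp: space_pair_measure)
  also have "\<dots> \<in> sets ((MZ \<Otimes>\<^sub>M MY) \<Otimes>\<^sub>M MX)"
    by measurable
  finally have "(\<lambda>w. emeasure (K (fst w)) {x. (x, snd w, fst w) \<in> E}) \<in> borel_measurable (MZ \<Otimes>\<^sub>M MY)"
    by (rule emeasure_measurable_subprob_algebra2) (rule measurable_prob_algebraD, measurable)
  then show ?thesis by (simp add: case_prod_beta)
qed

section \<open>Hoelder's inequality and the Renyi divergence\<close>

text \<open>Hoelder for \<open>p\<close> and the indicator of \<open>A\<close>, obtained by
  integrating Young's inequality for the two functions normalised to integral 1. The cases where a
  normalising constant vanishes are split off.\<close>

lemma (in prob_space) Holder_emeasure_density:
  fixes p :: "'a \<Rightarrow> real"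
  assumes p[measurable]: "p \<in> borel_measurable M" and nn: "\<And>x. 0 \<le> p x" and \<alpha>: "\<alpha> > 1"
    and A[measurable]: "A \<in> sets M" and fin: "(\<integral>\<^sup>+ x. ennreal (p x powr \<alpha>) \<partial>M) < \<infinity>"
  shows "emeasure (density M p) A
    \<le> ennreal (enn2real (\<integral>\<^sup>+ x. ennreal (p x powr \<alpha>) \<partial>M) powr (1 / \<alpha>) * prob A powr ((\<alpha> - 1) / \<alpha>))"
proof -
  define I where "I = enn2real (\<integral>\<^sup>+ x. ennreal (p x powr \<alpha>) \<partial>M)"
  define m where "m = prob A"
  have I: "(\<integral>\<^sup>+ x. ennreal (p x powr \<alpha>) \<partial>M) = ennreal I"
    using fin by (simp add: I_def)
  have m: "emeasure M A = ennreal m" by (simp add: m_def emeasure_eq_measure)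
  have em: "emeasure (density M p) A = (\<integral>\<^sup>+ x. ennreal (p x) * indicator A x \<partial>M)"
    by (simp add: emeasure_density)
  consider "I = 0" | "m = 0" | "I > 0" "m > 0"
    using I_def m_def enn2real_nonneg measure_nonneg by (metis less_eq_real_def)
  then have "emeasure (density M p) A \<le> ennreal (I powr (1 / \<alpha>) * m powr ((\<alpha> - 1) / \<alpha>))"
  proof cases
    case 1
    then have "AE x in M. p x powr \<alpha> = 0"
      using I by (simp add: nn_integral_0_iff_AE)
    then have "AE x in M. ennreal (p x) * indicator A x = 0"
      by eventually_elim (use nn in auto)
    then have "emeasure (density M p) A = 0"
      unfolding em by (subst nn_integral_0_iff_AE) auto
    then show ?thesis by simp
  next
    case 2
    then have "A \<in> null_sets M" using m by auto
    then have "A \<in> null_sets (density M p)"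
      by (rule absolutely_continuousI_density[unfolded absolutely_continuous_def, THEN subsetD, rotated]) simp
    then have "emeasure (density M p) A = 0" by (rule null_setsD1)
    then show ?thesis by simp
  next
    case 3
    define C where "C = I powr (1 / \<alpha>) * m powr ((\<alpha> - 1) / \<alpha>)"
    have C: "C > 0" using 3 by (simp add: C_def)
    \<comment> \<open>Young with weights \<open>1 / \<alpha>\<close> and
      \<open>(\<alpha> - 1) / \<alpha>\<close> for \<open>p x powr \<alpha> / I\<close> and
      \<open>1 / m\<close>, the latter being the value on \<open>A\<close> of its normalised
      indicator. \<open>C\<close> is the claimed bound, chosen so that the product of powers is
      \<open>p x / C\<close>.\<close>
    have Young: "p x \<le> C * (p x powr \<alpha> / (\<alpha> * I) + (\<alpha> - 1) / (\<alpha> * m))" for x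
    proof (cases "p x = 0")
      case True then show ?thesis using 3 C \<alpha> by simp
    next
      case False
      then have px: "p x > 0" using nn[of x] by simp
      have "(p x powr \<alpha> / I) powr (1 / \<alpha>) * (1 / m) powr ((\<alpha> - 1) / \<alpha>)
          \<le> 1 / \<alpha> * (p x powr \<alpha> / I) + (\<alpha> - 1) / \<alpha> * (1 / m)"
        using 3 px \<alpha> by (intro Youngs_inequality_0) (auto simp: field_simps)
      also have "(p x powr \<alpha> / I) powr (1 / \<alpha>) * (1 / m) powr ((\<alpha> - 1) / \<alpha>) = p x / C"
        using 3 px \<alpha> by (simp add: C_def powr_divide powr_powr)
      finally show ?thesis using C by (simp add: field_simps)
    qed
    have "emeasure (density M p) A
        \<le> (\<integral>\<^sup>+ x. ennreal (C / (\<alpha> * I)) * ennreal (p x powr \<alpha>)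
              + ennreal (C * (\<alpha> - 1) / (\<alpha> * m)) * indicator A x \<partial>M)"
      unfolding em
    proof (intro nn_integral_mono)
      fix x
      have "ennreal (p x) \<le> ennreal (C / (\<alpha> * I)) * ennreal (p x powr \<alpha>)
              + ennreal (C * (\<alpha> - 1) / (\<alpha> * m))"
        using Young[of x] 3 C \<alpha>
        by (simp add: ennreal_mult'[symmetric] ennreal_plus[symmetric] algebra_simps del: ennreal_plus)
      then show "ennreal (p x) * indicator A x \<le> ennreal (C / (\<alpha> * I)) * ennreal (p x powr \<alpha>)
              + ennreal (C * (\<alpha> - 1) / (\<alpha> * m)) * indicator A x"
        by (simp split: split_indicator)
    qed
    also have "\<dots> = ennreal (C / (\<alpha> * I)) * ennreal I + ennreal (C * (\<alpha> - 1) / (\<alpha> * m)) * ennreal m"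
      by (simp add: nn_integral_add nn_integral_cmult I m)
    \<comment> \<open>The two terms are \<open>C / \<alpha>\<close> and
      \<open>C * (\<alpha> - 1) / \<alpha>\<close>.\<close>
    also have "\<dots> = ennreal C"
      using 3 C \<alpha> by (simp add: ennreal_mult'[symmetric] ennreal_plus[symmetric] field_simps del: ennreal_plus)
    finally show ?thesis by (simp add: C_def)
  qed
  then show ?thesis by (simp add: I_def m_def)
qed

lemma exp_ereal_mono: "x \<le> y \<Longrightarrow> exp_ereal x \<le> exp_ereal y"
  by (cases x; cases y) (auto simp: exp_ereal_def)

text \<open>For \<open>c > 0\<close> the infinite values stay in place: at \<open>x = 0\<close> the
  exponent is \<open>-\<infinity>\<close>, in agreement with \<open>0 powr c = 0\<close>.\<close>

lemma exp_ereal_ln_ennreal: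
  assumes "c > 0"
  shows "exp_ereal (ereal c * ln_ennreal x) = (if x = \<infinity> then \<infinity> else ennreal (enn2real x powr c))"
  using assms by (cases x) (auto simp: exp_ereal_def ln_ennreal_def powr_def mult.commute)

text \<open>\<open>R\<close> itself serves as the dominating measure; its own density is 1, so the
  second factor of the integrand disappears.\<close>

lemma renyi_integral_absolutely_continuous:
  assumes P: "prob_space P" and R: "prob_space R" and sets: "sets P = sets R" and ac: "absolutely_continuous R P"
  obtains p :: "'a \<Rightarrow> real" where "p \<in> borel_measurable R" "\<And>x. 0 \<le> p x" "P = density R p"
    "renyi_integral \<alpha> P R = (\<integral>\<^sup>+ x. ennreal (p x powr \<alpha>) \<partial>R)"
proof -
  interpret P: prob_space P by fact
  interpret R: prob_space R by fact
  \<comment> \<open>The derivative is finite almost everywhere, so making it real-valued changes it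
    only on a null set.\<close>
  define p where "p x = enn2real (RN_deriv R P x)" for x
  have p[measurable]: "p \<in> borel_measurable R" unfolding p_def[abs_def] by measurable
  have nn: "0 \<le> p x" for x by (simp add: p_def)
  have "P = density R (RN_deriv R P)"
    using R.density_RN_deriv[OF ac sets] by simp
  also have "\<dots> = density R p"
  proof (rule density_cong)
    show "AE x in R. RN_deriv R P x = ennreal (p x)"
      using R.RN_deriv_finite[OF P.sigma_finite_measure_axioms ac sets]
      by eventually_elim (simp add: p_def less_top)
  qed auto
  finally have Pd: "P = density R p" .
  have "renyi_integral \<alpha> P R = (\<integral>\<^sup>+ x. ennreal (p x powr \<alpha> * 1 powr (1 - \<alpha>)) \<partial>R)"
    by (rule renyi_integral_density[OF R.sigma_finite_measure_axioms p _ nn _ Pd _ P R])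
       (simp_all add: density_1)
  with that[OF p nn Pd] show ?thesis by simp
qed

text \<open>Hoelder's bound in terms of the divergence. A bound \<open>b\<close> on
  \<open>R A\<close> replaces \<open>R A\<close> itself, so that one \<open>b\<close> can serve all
  competing kernels.\<close>

lemma emeasure_le_renyi_div:
  assumes P: "prob_space P" and R: "prob_space R" and sets: "sets P = sets R"
    and \<alpha>: "\<alpha> > 1" and A: "A \<in> sets R" and pos: "b > 0" and le: "emeasure R A \<le> ennreal b"
  shows "emeasure P A \<le> ennreal (b powr ((\<alpha> - 1) / \<alpha>))
    * exp_ereal (ereal ((\<alpha> - 1) / \<alpha>) * renyi_div \<alpha> P R)"
proof -
  interpret R: prob_space R by fact
  show ?thesis
  proof (cases "absolutely_continuous R P \<and> renyi_integral \<alpha> P R < \<infinity>")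
    case False
    \<comment> \<open>The right-hand side is then infinite because \<open>b > 0\<close>; for
      \<open>b = 0\<close> the product would be 0.\<close>
    have "renyi_div \<alpha> P R = \<infinity>"
      using False \<alpha> by (auto simp: renyi_div_def ln_ennreal_def not_less top_unique)
    then show ?thesis
      using \<alpha> pos by (simp add: exp_ereal_def ennreal_mult_top)
  next
    case True
    obtain p :: "'a \<Rightarrow> real" where p: "p \<in> borel_measurable R" "\<And>x. 0 \<le> p x" "P = density R p"
      "renyi_integral \<alpha> P R = (\<integral>\<^sup>+ x. ennreal (p x powr \<alpha>) \<partial>R)"
      using renyi_integral_absolutely_continuous[OF P R sets] True by metis
    let ?I = "renyi_integral \<alpha> P R"
    have "emeasure P A \<le> ennreal (enn2real ?I powr (1 / \<alpha>) * measure R A powr ((\<alpha> - 1) / \<alpha>))"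
      using R.Holder_emeasure_density[OF p(1,2) \<alpha> A] True p(3,4) by simp
    also have "\<dots> \<le> ennreal (b powr ((\<alpha> - 1) / \<alpha>) * enn2real ?I powr (1 / \<alpha>))"
    proof -
      have "measure R A \<le> b"
        using le pos by (simp add: R.emeasure_eq_measure)
      then have "measure R A powr ((\<alpha> - 1) / \<alpha>) \<le> b powr ((\<alpha> - 1) / \<alpha>)"
        using \<alpha> by (intro powr_mono2) auto
      then show ?thesis
        by (subst mult.commute) (intro ennreal_leI mult_right_mono, auto)
    qed
    also have "\<dots> = ennreal (b powr ((\<alpha> - 1) / \<alpha>)) * ennreal (enn2real ?I powr (1 / \<alpha>))"
      by (simp add: ennreal_mult)
    also have "ennreal (enn2real ?I powr (1 / \<alpha>)) = exp_ereal (ereal ((\<alpha> - 1) / \<alpha>) * renyi_div \<alpha> P R)"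
    proof -
      have "ereal ((\<alpha> - 1) / \<alpha>) * renyi_div \<alpha> P R = ereal (1 / \<alpha>) * ln_ennreal ?I"
        using True \<alpha> by (simp add: renyi_div_def mult.assoc[symmetric])
      then show ?thesis
        using True \<alpha> exp_ereal_ln_ennreal[of "1 / \<alpha>" ?I] by auto
    qed
    finally show ?thesis .
  qed
qed

section \<open>Passing to the infimum over kernels\<close>

lemma ln_ennreal_le_of_le_exp_ereal: "t \<le> exp_ereal x \<Longrightarrow> ln_ennreal t \<le> x"
proof (cases x)
  case (real r)
  assume "t \<le> exp_ereal x"
  then have t: "t \<le> ennreal (exp r)" using real by (simp add: exp_ereal_def)
  then have "t \<noteq> \<infinity>" by (auto simp: top_unique)
  moreover have "ln (enn2real t) \<le> r" if "t \<noteq> 0"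
  proof -
    have "0 < enn2real t" using that \<open>t \<noteq> \<infinity>\<close> by (simp add: enn2real_positive_iff less_top[symmetric] zero_less_iff_neq_zero)
    moreover have "enn2real t \<le> exp r" using t enn2real_leI by simp
    ultimately show ?thesis by (metis ln_exp ln_le_cancel_iff exp_gt_zero)
  qed
  ultimately show ?thesis using real by (simp add: ln_ennreal_def)
qed (auto simp: exp_ereal_def ln_ennreal_def)

text \<open>Dividing by \<open>b\<close> and taking logarithms turns the hypothesis into one lower
  bound for every \<open>D Q\<close>, hence for their infimum, attained or not; then the steps are
  undone.\<close>

lemma le_exp_ereal_INF:
  assumes c: "c > 0" and b: "b > 0"
    and le: "\<And>Q. Q \<in> S \<Longrightarrow> a \<le> ennreal b * exp_ereal (ereal c * D Q)"
  shows "a \<le> ennreal b * exp_ereal (ereal c * (INF Q\<in>S. D Q))"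
proof -
  define t where "t = a / ennreal b"
  have b': "ennreal b \<noteq> 0" "ennreal b \<noteq> top" using b by auto
  have a: "a = ennreal b * t"
    using b' by (simp add: t_def ennreal_times_divide ennreal_mult_divide_eq mult.commute)
  have exp_ln: "exp_ereal (ln_ennreal t) = t"
    using exp_ereal_ln_ennreal[of 1 t] by (cases t) auto
  have "ereal (1 / c) * ln_ennreal t \<le> D Q" if "Q \<in> S" for Q
  proof -
    have "ennreal b * t \<le> ennreal b * exp_ereal (ereal c * D Q)"
      using le[OF that] a by simp
    then have "t \<le> exp_ereal (ereal c * D Q)"
      using b' by (simp add: ennreal_mult_le_mult_iff)
    then have "ln_ennreal t \<le> ereal c * D Q"
      by (rule ln_ennreal_le_of_le_exp_ereal)
    then have "ereal (1 / c) * ln_ennreal t \<le> ereal (1 / c) * (ereal c * D Q)"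
      using c by (intro ereal_mult_left_mono) auto
    then show ?thesis using c by (simp add: mult.assoc[symmetric])
  qed
  then have "ereal (1 / c) * ln_ennreal t \<le> (INF Q\<in>S. D Q)"
    by (rule INF_greatest)
  then have "ereal c * (ereal (1 / c) * ln_ennreal t) \<le> ereal c * (INF Q\<in>S. D Q)"
    using c by (intro ereal_mult_left_mono) auto
  then have "ln_ennreal t \<le> ereal c * (INF Q\<in>S. D Q)"
    using c by (simp add: mult.assoc[symmetric])
  then have "t \<le> exp_ereal (ereal c * (INF Q\<in>S. D Q))"
    using exp_ereal_mono exp_ln by metis
  then show ?thesis unfolding a by (rule mult_left_mono) simp
qed

section \<open>The bound on the probability of the event\<close>

theorem theorem1:
  fixes MX :: "'x measure" and MY :: "'y measure" and MZ :: "'z measure"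
    and P :: "('x \<times> 'y \<times> 'z) measure"
    and KX :: "'z \<Rightarrow> 'x measure" and KY :: "'z \<Rightarrow> 'y measure"
    and E :: "('x \<times> 'y \<times> 'z) set" and \<alpha> :: real
  assumes "prob_space P" and "sets P = sets (MX \<Otimes>\<^sub>M MY \<Otimes>\<^sub>M MZ)"
    and "cond_distr P MX coord_X MZ coord_Z KX"
    and "cond_distr P MY coord_Y MZ coord_Z KY"
    and "absolutely_continuous (markov_product MX MY MZ (distr P MZ coord_Z) KY KX) P"
    and "E \<in> sets P" and "\<alpha> \<ge> 1"
  shows "emeasure P E \<le>
    ennreal (enn2real (\<integral>\<^sup>+ z. esssup (KY z) (\<lambda>y. emeasure (KX z) {x. (x, y, z) \<in> E}) \<partial>distr P MZ coord_Z)
      powr ((\<alpha> - 1) / \<alpha>))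
    * exp_ereal (ereal ((\<alpha> - 1) / \<alpha>) * cond_sibson_mi \<alpha> MX MY MZ P KX)"
proof -
  interpret P: prob_space P by fact
  let ?M = "MX \<Otimes>\<^sub>M MY \<Otimes>\<^sub>M MZ"
  define R where "R = distr P MZ coord_Z"
  define f where "f z y = emeasure (KX z) {x. (x, y, z) \<in> E}" for z y
  define g where "g z = esssup (KY z) (f z)" for z
  define G where "G = (\<integral>\<^sup>+ z. g z \<partial>R)"
  let ?mp = "\<lambda>K. markov_product MX MY MZ R K KX"
  note sets_P[measurable_cong] = assms(2)
  have E[measurable]: "E \<in> sets ?M" using assms(2,6) by simp
  have KX[measurable]: "KX \<in> MZ \<rightarrow>\<^sub>M prob_algebra MX" and KY[measurable]: "KY \<in> MZ \<rightarrow>\<^sub>M prob_algebra MY"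
    using assms(3,4) by (auto simp: cond_distr_def)
  have coord_Z: "coord_Z \<in> P \<rightarrow>\<^sub>M MZ" by measurable
  interpret R: prob_space R
    unfolding R_def using coord_Z by (rule P.prob_space_distr)
  have R: "R \<in> space (prob_algebra MZ)"
    by (simp add: space_prob_algebra R.prob_space_axioms) (simp add: R_def)
  have space_R[simp]: "space R = space MZ" by (simp add: R_def)
  have f[measurable]: "case_prod f \<in> borel_measurable (MZ \<Otimes>\<^sub>M MY)"
    using measurable_emeasure_slice[OF E KX] by (simp add: f_def[abs_def])
  have g[measurable]: "g \<in> borel_measurable MZ"
    unfolding g_def by (rule measurable_esssup_kernel[OF f KY])
  have f_meas: "f z \<in> borel_measurable (KY z)" if "z \<in> space MZ" for z
    using measurable_Pair2[OF f that] measurable_space[OF KY that]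
    by (simp add: space_prob_algebra cong: measurable_cong_sets)
  define N where "N = {w \<in> space ?M. g (coord_Z w) < f (coord_Z w) (coord_Y w)}"
  have "(\<lambda>w. case_prod f (coord_Z w, coord_Y w)) \<in> borel_measurable ?M"
    by (rule measurable_compose[OF _ f]) measurable
  then have N[measurable]: "N \<in> sets ?M"
    unfolding N_def by measurable

  \<comment> \<open>A competing kernel need not be dominated by \<open>KY\<close>, so the essential supremum is only an upper
    bound for the slices of \<open>E\<close> outside \<open>N\<close>. Since \<open>P\<close> does not charge \<open>N\<close>, \<open>E\<close> may be replaced
    by \<open>E - N\<close>.\<close>
  have "emeasure (?mp KY) N = (\<integral>\<^sup>+ z. \<integral>\<^sup>+ y. emeasure (KX z) {x. (x, y, z) \<in> N} \<partial>KY z \<partial>R)"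
    by (rule emeasure_markov_product[OF R KY KX N])
  also have "\<dots> = (\<integral>\<^sup>+ z. 0 \<partial>R)"
  proof (intro nn_integral_cong)
    fix z
    have "AE y in KY z. f z y \<le> g z"
      unfolding g_def by (rule esssup_AE)
    \<comment> \<open>Membership in \<open>N\<close> puts a condition on \<open>y\<close> and
      \<open>z\<close> only, so the slice is empty wherever \<open>f z y \<le> g z\<close>.\<close>
    then have "AE y in KY z. emeasure (KX z) {x. (x, y, z) \<in> N} = 0"
      by eventually_elim (simp add: N_def not_less[symmetric])
    then have "(\<integral>\<^sup>+ y. emeasure (KX z) {x. (x, y, z) \<in> N} \<partial>KY z) = (\<integral>\<^sup>+ y. 0 \<partial>KY z)"
      by (rule nn_integral_cong_AE)
    then show "(\<integral>\<^sup>+ y. emeasure (KX z) {x. (x, y, z) \<in> N} \<partial>KY z) = 0" by simp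
  qed
  finally have "N \<in> null_sets (?mp KY)"
    using N by (simp add: null_sets_def sets_markov_product[OF R KY KX])
  with assms(5) have N_null: "N \<in> null_sets P"
    by (auto simp: absolutely_continuous_def R_def)
  then have PE: "emeasure P E = emeasure P (E - N)"
    using assms(6) by (simp add: emeasure_Diff_null_set)

  have bound: "emeasure (?mp K) (E - N) \<le> G" if K: "K \<in> MZ \<rightarrow>\<^sub>M prob_algebra MY" for K
  proof -
    have "emeasure (?mp K) (E - N) = (\<integral>\<^sup>+ z. \<integral>\<^sup>+ y. emeasure (KX z) {x. (x, y, z) \<in> E - N} \<partial>K z \<partial>R)"
      by (rule emeasure_markov_product[OF R K KX]) simp
    also have "\<dots> \<le> G"
      unfolding G_def
    proof (intro nn_integral_mono)
      fix z assume "z \<in> space R"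
      then have z: "z \<in> space MZ" by simp
      have Kz: "space (K z) = space MY" "prob_space (K z)"
        using measurable_space[OF K z] by (auto simp: space_prob_algebra dest: sets_eq_imp_space_eq)
      \<comment> \<open>The slice is either that of \<open>E\<close>, of mass
        \<open>f z y \<le> g z\<close>, or empty. The bound holds at every \<open>y\<close>, so it
        may be integrated against any \<open>K z\<close>, even one singular to
        \<open>KY z\<close>.\<close>
      have "emeasure (KX z) {x. (x, y, z) \<in> E - N} \<le> g z" for y
      proof (cases "f z y \<le> g z")
        case True
        have "{x. (x, y, z) \<in> E - N} = {x. (x, y, z) \<in> E}"
          using True by (auto simp: N_def)
        then show ?thesis using True by (simp add: f_def)
      next
        case False
        then have empty: "{x. (x, y, z) \<in> E - N} = {}"
          using sets.sets_into_space[OF E] by (auto simp: N_def)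
        show ?thesis unfolding empty by simp
      qed
      then have "(\<integral>\<^sup>+ y. emeasure (KX z) {x. (x, y, z) \<in> E - N} \<partial>K z) \<le> (\<integral>\<^sup>+ y. g z \<partial>K z)"
        by (intro nn_integral_mono)
      also have "\<dots> = g z"
        using Kz(2) by (simp add: prob_space.emeasure_space_1)
      finally show "(\<integral>\<^sup>+ y. emeasure (KX z) {x. (x, y, z) \<in> E - N} \<partial>K z) \<le> g z" .
    qed
    finally show ?thesis .
  qed

  \<comment> \<open>This gives finiteness of \<open>G\<close>, so that \<open>enn2real G\<close> is
    its true value and not the default 0.\<close>
  have "g z \<le> 1" if "z \<in> space MZ" for z
    unfolding g_def
  proof (rule esssup_I[OF f_meas[OF that]])
    show "AE y in KY z. f z y \<le> 1"
      using measurable_space[OF KX that]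
      by (simp add: f_def space_prob_algebra prob_space.emeasure_le_1)
  qed
  then have "G \<le> (\<integral>\<^sup>+ z. 1 \<partial>R)"
    unfolding G_def by (intro nn_integral_mono) simp
  then have "G \<le> 1" using R.emeasure_space_1 by simp

  then have G_fin: "G < top" by (rule le_less_trans) simp

  have "emeasure P E \<le> ennreal (enn2real G powr ((\<alpha> - 1) / \<alpha>))
    * exp_ereal (ereal ((\<alpha> - 1) / \<alpha>) * cond_sibson_mi \<alpha> MX MY MZ P KX)"
  proof -
    consider "G = 0" | "G > 0" "\<alpha> = 1" | "G > 0" "\<alpha> > 1"
      using \<open>\<alpha> \<ge> 1\<close> by (metis less_eq_real_def not_gr_zero)
    then show ?thesis
    proof cases
      \<comment> \<open>The right-hand side is 0, also for \<open>\<alpha> = 1\<close> since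
        \<open>0 powr 0 = 0\<close>. So \<open>P E = 0\<close> is required, and it follows from
        absolute continuity.\<close>
      case 1
      then have "E - N \<in> null_sets (?mp KY)"
        using bound[OF KY] by (simp add: null_sets_def sets_markov_product[OF R KY KX])
      with assms(5) have "E - N \<in> null_sets P"
        by (auto simp: absolutely_continuous_def R_def)
      then show ?thesis using PE by (simp add: null_setsD1)
    next
      \<comment> \<open>Both exponents vanish, even for infinite divergence since
        \<open>0 * \<infinity> = 0\<close>, and the right-hand side is 1.\<close>
      case 2
      then have "enn2real G > 0" using G_fin by (simp add: enn2real_positive_iff)
      then show ?thesis using 2 P.emeasure_le_1 by (simp add: exp_ereal_def zero_ereal_def[symmetric])
    next
      case 3
      have pos: "enn2real G > 0" using 3 G_fin by (simp add: enn2real_positive_iff)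
      have Ge: "G = ennreal (enn2real G)" using G_fin by simp
      show ?thesis
        unfolding cond_sibson_mi_def R_def[symmetric]
      proof (rule le_exp_ereal_INF)
        fix K assume K: "K \<in> MZ \<rightarrow>\<^sub>M prob_algebra MY"
        show "emeasure P E \<le> ennreal (enn2real G powr ((\<alpha> - 1) / \<alpha>))
            * exp_ereal (ereal ((\<alpha> - 1) / \<alpha>) * renyi_div \<alpha> P (?mp K))"
          unfolding PE
        proof (rule emeasure_le_renyi_div)
          show "prob_space (?mp K)" by (rule prob_space_markov_product[OF R K KX])
          show "sets P = sets (?mp K)" "E - N \<in> sets (?mp K)"
            using assms(2) by (simp_all add: sets_markov_product[OF R K KX])
          show "emeasure (?mp K) (E - N) \<le> ennreal (enn2real G)"
            using bound[OF K] Ge by simp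
        qed (use 3 pos P.prob_space_axioms in auto)
      qed (use 3 pos in auto)
    qed
  qed
  then show ?thesis
    by (simp add: G_def g_def f_def[abs_def] R_def)
qed

end
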